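(* Let $\beta\in\mathbb{R}^h_{++}$ with $\lVert\beta\rVert_1\le 1$, let $0\le\underline{u}_j<\overline{u}_j$ for $j\in[h]$, and define $s:[0,1]^h\to\mathbb{R}$ by $s(w):=\psi_\beta(u)$ where $u_j=\underline{u}_j+(\overline{u}_j-\underline{u}_j)w_j$ for all $j\in[h]$. Then $s$ is supermodular over $Q=\{0,1\}^h$. Moreover, with $\mathcal{U}=[0,1]^h$, $\mathrm{convenv}_{\mathcal{U}}(s)=\mathrm{convenv}_{Q}(s)$.
   Context: $\psi_\beta(u)=\prod_{j\in[h]}u_j^{\beta_j}$, and $[h]=\{1,\dots,h\}$. A function $f:D\to\mathbb{R}$ on a product set $D=\prod_{j\in[h]}D_j\subseteq\mathbb{R}^h$ ($D_j\subseteq\mathbb{R}$), here $D=\{0,1\}^h$, is supermodular over $D$ if for all $w^1,w^2\in D$ and $d\in\mathbb{R}^h_+$ such that $w^1\le w^2$ (entry-wise) and $w^1+d,w^2+d\in D$, one has $f(w^1+d)-f(w^1)\le f(w^2+d)-f(w^2)$. For a function $f$ and a closed set $D\subseteq\mathbb{R}^p$, a convex function $f':\mathrm{conv}(D)\to\mathbb{R}$ is a convex underestimator of $f$ over $D$ if $f'(x)\le f(x)$ for all $x\in D$; the convex envelope $\mathrm{convenv}_D(f):\mathrm{conv}(D)\to\mathbb{R}$ is the pointwise maximum convex underestimator of $f$ over $D$. *)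

theory Defs
  imports "HOL-Analysis.Analysis"
begin

definition psi :: "real ^ 'h \<Rightarrow> real ^ 'h \<Rightarrow> real" where
  "psi \<beta> u = (\<Prod>j\<in>UNIV. (u $ j) powr (\<beta> $ j))"

(* The order on vectors is entry-wise. *)
definition supermodular_on :: "(real ^ 'h) set \<Rightarrow> (real ^ 'h \<Rightarrow> real) \<Rightarrow> bool" where
  "supermodular_on D f \<longleftrightarrow>
     (\<forall>w1\<in>D. \<forall>w2\<in>D. \<forall>d. 0 \<le> d \<longrightarrow> w1 \<le> w2 \<longrightarrow> w1 + d \<in> D \<longrightarrow> w2 + d \<in> D \<longrightarrow>
        f (w1 + d) - f w1 \<le> f (w2 + d) - f w2)"

definition convex_underestimator ::
    "'a::real_vector set \<Rightarrow> ('a \<Rightarrow> real) \<Rightarrow> ('a \<Rightarrow> real) \<Rightarrow> bool" where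
  "convex_underestimator D f g \<longleftrightarrow> convex_on (convex hull D) g \<and> (\<forall>x\<in>D. g x \<le> f x)"

definition is_convex_envelope ::
    "'a::real_vector set \<Rightarrow> ('a \<Rightarrow> real) \<Rightarrow> ('a \<Rightarrow> real) \<Rightarrow> bool" where
  "is_convex_envelope D f g \<longleftrightarrow> convex_underestimator D f g \<and>
     (\<forall>g'. convex_underestimator D f g' \<longrightarrow> (\<forall>x\<in>convex hull D. g' x \<le> g x))"

(* A function with domain conv(D) is represented by its extension that is undefined outside
   conv(D), so that the envelope is unique. It exists as soon as f has some convex
   underestimator over D, see is_convex_envelope_convenv. *)
definition convenv :: "'a::real_vector set \<Rightarrow> ('a \<Rightarrow> real) \<Rightarrow> 'a \<Rightarrow> real" where
  "convenv D f = (THE g. g \<in> extensional (convex hull D) \<and> is_convex_envelope D f g)"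


lemma is_convex_envelope_unique:
  assumes "is_convex_envelope D f g" "is_convex_envelope D f g'" "x \<in> convex hull D"
  shows "g x = g' x"
proof (rule order_antisym)
  show "g x \<le> g' x" using assms unfolding is_convex_envelope_def by blast
  show "g' x \<le> g x" using assms unfolding is_convex_envelope_def by blast
qed

lemma is_convex_envelope_convenv:
  assumes ex: "convex_underestimator D f g0"
  shows "convenv D f \<in> extensional (convex hull D)" "is_convex_envelope D f (convenv D f)"
proof -
  let ?C = "convex hull D"
  let ?G = "{g. convex_underestimator D f g}"
  define h where "h = (\<lambda>x\<in>?C. SUP g\<in>?G. g x)"
  have bdd: "bdd_above ((\<lambda>g. g x) ` ?G)" if "x \<in> ?C" for x
  proof -
    from that obtain S u where S: "finite S" "S \<subseteq> D" "\<forall>v\<in>S. 0 \<le> u v" "sum u S = 1"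
      "(\<Sum>v\<in>S. u v *\<^sub>R v) = x"
      unfolding convex_hull_explicit by auto
    have "g x \<le> (\<Sum>v\<in>S. u v * f v)" if g: "convex_underestimator D f g" for g
    proof -
      have c: "convex_on ?C g" and le: "\<And>v. v \<in> D \<Longrightarrow> g v \<le> f v"
        using g unfolding convex_underestimator_def by auto
      have "S \<noteq> {}" using S(4) by auto
      moreover have "S \<subseteq> ?C" using S(2) hull_subset[of D convex] by blast
      ultimately have "g (\<Sum>v\<in>S. u v *\<^sub>R v) \<le> (\<Sum>v\<in>S. u v * g v)"
        using S(3) by (intro convex_on_sum[OF S(1) _ c S(4)]) auto
      also have "\<dots> \<le> (\<Sum>v\<in>S. u v * f v)"
        using S(2,3) le by (intro sum_mono mult_left_mono) auto
      finally show ?thesis using S(5) by simp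
    qed
    then show ?thesis by (intro bdd_aboveI2) auto
  qed
  have upper: "g x \<le> h x" if "convex_underestimator D f g" "x \<in> ?C" for g x
    using cSUP_upper[of g ?G "\<lambda>g. g x"] that bdd[of x] unfolding h_def by simp
  have least: "h x \<le> b" if "x \<in> ?C" "\<And>g. convex_underestimator D f g \<Longrightarrow> g x \<le> b" for x b
  proof -
    have "(SUP g\<in>?G. g x) \<le> b" using ex that(2) by (intro cSUP_least) blast+
    then show ?thesis using that(1) unfolding h_def by simp
  qed
  have "convex_on ?C h"
  proof (rule convex_onI)
    fix t x y assume t: "0 < t" "t < (1::real)" and xy: "x \<in> ?C" "y \<in> ?C"
    let ?z = "(1 - t) *\<^sub>R x + t *\<^sub>R y"
    have "?z \<in> ?C" using t xy by (intro convexD[OF convex_convex_hull]) auto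
    moreover have "g ?z \<le> (1 - t) * h x + t * h y" if g: "convex_underestimator D f g" for g
    proof -
      have "g ?z \<le> (1 - t) * g x + t * g y"
        using g t xy convex_onD[of ?C g t x y] unfolding convex_underestimator_def by auto
      also have "\<dots> \<le> (1 - t) * h x + t * h y"
        using upper[OF g] t xy by (intro add_mono mult_left_mono) auto
      finally show ?thesis .
    qed
    ultimately show "h ?z \<le> (1 - t) * h x + t * h y" by (rule least)
  qed (rule convex_convex_hull)
  moreover have "h x \<le> f x" if "x \<in> D" for x
    using that by (intro least) (auto simp: convex_underestimator_def hull_inc)
  ultimately have env: "is_convex_envelope D f h"
    using upper unfolding is_convex_envelope_def convex_underestimator_def by auto
  have "h \<in> extensional ?C" unfolding h_def by simp
  moreover have "g = h" if "g \<in> extensional ?C" "is_convex_envelope D f g" for g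
    using that(1) \<open>h \<in> extensional ?C\<close> is_convex_envelope_unique[OF that(2) env]
    by (rule extensionalityI)
  ultimately have "convenv D f = h"
    unfolding convenv_def using env by (intro the_equality) blast+
  then show "convenv D f \<in> extensional ?C" "is_convex_envelope D f (convenv D f)"
    using env \<open>h \<in> extensional ?C\<close> by auto
qed

end

theory Submission
  imports Defs
begin

text \<open>
  Supermodularity on the vertices is inherited from the factors: a product of nonnegative
  nondecreasing functions with increasing differences has increasing differences. For the envelopes,
  \<open>s\<close> is concave in each coordinate separately, so replacing the fractional coordinates by
  0 and 1 one at a time shows that a convex function below \<open>s\<close> on the vertices is below
  \<open>s\<close> on the whole cube. Hence the two problems have the same convex underestimators.
\<close>

text \<open>Splitting off one factor, the difference of products is
  \<open>(b i - a i) * prod b I + a i * (prod b I - prod a I)\<close>. Each factor in the two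
  summands is nonnegative and grows when \<open>a\<close>, \<open>b\<close> are replaced by
  \<open>c\<close>, \<open>d\<close>.\<close>

lemma prod_increasing_differences:
  fixes a b c d :: "'i \<Rightarrow> real"
  assumes "\<And>i. i \<in> I \<Longrightarrow> 0 \<le> a i" "\<And>i. i \<in> I \<Longrightarrow> a i \<le> b i" "\<And>i. i \<in> I \<Longrightarrow> b i \<le> d i"
    and "\<And>i. i \<in> I \<Longrightarrow> a i \<le> c i" "\<And>i. i \<in> I \<Longrightarrow> c i \<le> d i"
    and "\<And>i. i \<in> I \<Longrightarrow> b i - a i \<le> d i - c i"
  shows "prod b I - prod a I \<le> prod d I - prod c I"
  using assms
proof (induction I rule: infinite_finite_induct)
  case (insert i I)
  have le: "prod a I \<le> prod b I" "prod b I \<le> prod d I" "0 \<le> prod b I"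
    using insert.prems by (force intro!: prod_mono prod_nonneg)+
  have "(b i - a i) * prod b I \<le> (d i - c i) * prod d I"
    using insert.prems[of i] le by (intro mult_mono) auto
  moreover have "a i * (prod b I - prod a I) \<le> c i * (prod d I - prod c I)"
    using insert.prems insert.IH le order.trans[OF insert.prems(1,4)[of i]]
    by (intro mult_mono) auto
  ultimately show ?case
    using insert.hyps by (simp add: algebra_simps)
qed auto

text \<open>The graph of the power lies below its tangent at the mean \<open>m\<close>. Averaging
  the tangent bound over \<open>a\<close> and \<open>b\<close> gives its value at \<open>m\<close>,
  which is \<open>m powr p\<close>. A zero mean has no such tangent, but then both weighted terms
  vanish.\<close>

lemma concave_powr:
  fixes a b p t :: real
  assumes "0 \<le> a" "0 \<le> b" "0 < p" "p \<le> 1" "0 \<le> t" "t \<le> 1"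
  shows "(1 - t) * a powr p + t * b powr p \<le> ((1 - t) * a + t * b) powr p"
proof (cases "(1 - t) * a + t * b = 0")
  case True
  then have "(1 - t) * a = 0" "t * b = 0"
    using assms by (simp_all add: add_nonneg_eq_0_iff)
  then show ?thesis using assms by auto
next
  case False
  define m where "m = (1 - t) * a + t * b"
  have m: "0 < m" using False assms unfolding m_def by (simp add: order.strict_iff_order)
  \<comment> \<open>The right-hand side is the tangent at \<open>m\<close>. After division by
    \<open>m powr p\<close> the bound is Young's inequality for \<open>x / m\<close> and 1 with
    weights \<open>p\<close> and \<open>1 - p\<close>.\<close>
  have tangent: "x powr p \<le> m powr p * (p * (x / m) + (1 - p))" if "0 \<le> x" for x
  proof (cases "x = 0")
    case True
    then show ?thesis using assms by simp
  next
    case False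
    then have "(x / m) powr p * 1 powr (1 - p) \<le> p * (x / m) + (1 - p) * 1"
      using that m assms by (intro Youngs_inequality_0) auto
    then have "m powr p * (x / m) powr p \<le> m powr p * (p * (x / m) + (1 - p))"
      by (intro mult_left_mono) auto
    then show ?thesis using that m by (simp add: powr_divide)
  qed
  have "(1 - t) * a powr p + t * b powr p
      \<le> (1 - t) * (m powr p * (p * (a / m) + (1 - p))) + t * (m powr p * (p * (b / m) + (1 - p)))"
    using tangent assms by (intro add_mono mult_left_mono) auto
  also have "\<dots> = m powr p * (p * (((1 - t) * a + t * b) / m) + (1 - p))"
    by (simp add: algebra_simps add_divide_distrib diff_divide_distrib)
  also have "\<dots> = m powr p" using m by (simp flip: m_def)
  finally show ?thesis unfolding m_def .
qed

definition vec_upd :: "'a ^ 'n \<Rightarrow> 'n \<Rightarrow> 'a \<Rightarrow> 'a ^ 'n" where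
  "vec_upd w j c = (\<chi> i. if i = j then c else w $ i)"

lemma vec_upd_nth [simp]: "vec_upd w j c $ i = (if i = j then c else w $ i)"
  by (simp add: vec_upd_def)

lemma convex_le_coordinatewise_concave:
  fixes f g :: "real ^ 'n \<Rightarrow> real"
  assumes g: "convex_on (cbox 0 1) g"
    and f: "\<And>w j. w \<in> cbox 0 1 \<Longrightarrow>
      (1 - w $ j) * f (vec_upd w j 0) + w $ j * f (vec_upd w j 1) \<le> f w"
    and vertices: "\<And>w. (\<And>j. w $ j \<in> {0, 1}) \<Longrightarrow> g w \<le> f w"
    and w: "w \<in> cbox 0 1"
  shows "g w \<le> f w"
proof -
  \<comment> \<open>\<open>J\<close> collects the coordinates that may be fractional. The induction
    removes one at a time; \<open>J = UNIV\<close> is the claim.\<close>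
  have "g w \<le> f w" if "w \<in> cbox 0 1" "\<And>j. j \<notin> J \<Longrightarrow> w $ j \<in> {0, 1}" for J w
    using finite[of J] that
  proof (induction J arbitrary: w rule: finite_induct)
    case empty
    then show ?case by (intro vertices) auto
  next
    case (insert j J)
    have w: "0 \<le> w $ j" "w $ j \<le> 1"
      using insert.prems(1) by (auto simp: mem_box_cart)
    have in_box: "vec_upd w j c \<in> cbox 0 1" if "c \<in> {0, 1}" for c
      using insert.prems(1) that by (auto simp: mem_box_cart)
    have le: "g (vec_upd w j c) \<le> f (vec_upd w j c)" if "c \<in> {0, 1}" for c
      using insert.prems(2) that by (intro insert.IH in_box) auto
    \<comment> \<open>The fractional entry itself is the weight that recovers \<open>w\<close> from
      its two roundings, so convexity of \<open>g\<close> and the hypothesis on \<open>f\<close> use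
      the same weights.\<close>
    have "w = (1 - w $ j) *\<^sub>R vec_upd w j 0 + w $ j *\<^sub>R vec_upd w j 1"
      by (simp add: vec_eq_iff algebra_simps)
    then have "g w \<le> (1 - w $ j) * g (vec_upd w j 0) + w $ j * g (vec_upd w j 1)"
      using convex_onD[OF g w in_box in_box, of 0 1] by simp
    also have "\<dots> \<le> (1 - w $ j) * f (vec_upd w j 0) + w $ j * f (vec_upd w j 1)"
      using le w by (intro add_mono mult_left_mono) auto
    also have "\<dots> \<le> f w" using f insert.prems(1) .
    finally show ?case .
  qed
  from this[of w UNIV] w show ?thesis by simp
qed

text \<open>The definition sees \<open>D\<close> and \<open>f\<close> only through the hull and the
  set of underestimators, so the equality holds whether or not an envelope exists.\<close>

lemma convenv_cong:
  assumes "\<And>g. convex_underestimator D f g \<longleftrightarrow> convex_underestimator D' f' g"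
    and "convex hull D = convex hull D'"
  shows "convenv D f = convenv D' f'"
  using assms by (simp add: convenv_def is_convex_envelope_def)

text \<open>With the other coordinates fixed, \<open>s\<close> is a constant
  \<open>R \<ge> 0\<close> times a concave power of an affine function of
  \<open>w $ j\<close>.\<close>

lemma psi_coordinatewise_concave:
  fixes \<beta> l d w :: "real ^ 'n"
  assumes "0 < \<beta> $ j" "\<beta> $ j \<le> 1" "0 \<le> l" "0 \<le> d" and w: "w \<in> cbox 0 1"
  defines "s \<equiv> \<lambda>w. psi \<beta> (\<chi> i. l $ i + d $ i * w $ i)"
  shows "(1 - w $ j) * s (vec_upd w j 0) + w $ j * s (vec_upd w j 1) \<le> s w"
proof -
  define R where "R = (\<Prod>i\<in>UNIV - {j}. (l $ i + d $ i * w $ i) powr (\<beta> $ i))"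
  have split: "s (vec_upd w j c) = (l $ j + d $ j * c) powr (\<beta> $ j) * R" for c
    by (simp add: s_def psi_def R_def prod.remove[of UNIV j])
  have "0 \<le> R" unfolding R_def by (intro prod_nonneg) auto
  have pos: "0 \<le> l $ j" "0 \<le> d $ j"
    using assms by (auto simp: less_eq_vec_def)
  have "w = vec_upd w j (w $ j)" by (simp add: vec_eq_iff)
  then have sw: "s w = (l $ j + d $ j * w $ j) powr (\<beta> $ j) * R" using split by metis
  have "(1 - w $ j) * (l $ j) powr (\<beta> $ j) + w $ j * (l $ j + d $ j) powr (\<beta> $ j)
      \<le> ((1 - w $ j) * l $ j + w $ j * (l $ j + d $ j)) powr (\<beta> $ j)"
    using assms pos by (intro concave_powr) (auto simp: mem_box_cart)
  also have "(1 - w $ j) * l $ j + w $ j * (l $ j + d $ j) = l $ j + d $ j * w $ j"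
    by (simp add: algebra_simps)
  finally show ?thesis
    using mult_right_mono[OF _ \<open>0 \<le> R\<close>] unfolding split sw
    by (fastforce simp: algebra_simps)
qed

lemma psi_supermodular_on_vertices:
  fixes \<beta> l d :: "real ^ 'n"
  assumes "0 \<le> \<beta>" "0 \<le> l" "0 \<le> d"
  shows "supermodular_on {w. \<forall>j. w $ j \<in> {0, 1}} (\<lambda>w. psi \<beta> (\<chi> i. l $ i + d $ i * w $ i))"
  unfolding supermodular_on_def psi_def
proof (intro ballI allI impI prod_increasing_differences)
  fix v w e :: "real ^ 'n" and i :: 'n
  let ?x = "\<lambda>u. (\<chi> i. l $ i + d $ i * u $ i) $ i powr (\<beta> $ i)"
  assume v: "v \<in> {w. \<forall>j. w $ j \<in> {0, 1}}" "w \<in> {w. \<forall>j. w $ j \<in> {0, 1}}"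
    "v + e \<in> {w. \<forall>j. w $ j \<in> {0, 1}}" "w + e \<in> {w. \<forall>j. w $ j \<in> {0, 1}}"
    and le: "0 \<le> e" "v \<le> w"
  have mono: "?x u \<le> ?x u'" if "0 \<le> u $ i" "u $ i \<le> u' $ i" for u u' :: "real ^ 'n"
    using assms that by (auto simp: less_eq_vec_def intro!: powr_mono2 mult_left_mono add_nonneg_nonneg)
  have ord: "0 \<le> v $ i" "0 \<le> w $ i" "v $ i \<le> w $ i" "0 \<le> e $ i"
    using v le by (auto simp: less_eq_vec_def) (metis insert_iff singletonD zero_le_one order.refl)+
  show "0 \<le> ?x v" by simp
  show "?x v \<le> ?x (v + e)" "?x (v + e) \<le> ?x (w + e)" "?x v \<le> ?x w" "?x w \<le> ?x (w + e)"
    by (rule mono; use ord in simp)+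
  \<comment> \<open>Here the restriction to vertices enters: if \<open>v $ i < w $ i\<close>, then
    \<open>w $ i = 1\<close>, which leaves no room for a positive \<open>e $ i\<close>. So the two
    differences of the factor are both zero or equal.\<close>
  have "e $ i = 0 \<or> v $ i = w $ i"
  proof -
    have "v $ i \<in> {0, 1}" "w $ i \<in> {0, 1}" "v $ i + e $ i \<in> {0, 1}" "w $ i + e $ i \<in> {0, 1}"
      using v by (simp_all flip: vector_add_component)
    then show ?thesis using ord by auto
  qed
  then show "?x (v + e) - ?x v \<le> ?x (w + e) - ?x w" by auto
qed

theorem proposition2:
  fixes \<beta> ul uu :: "real ^ 'h" and s :: "real ^ 'h \<Rightarrow> real" and U Q :: "(real ^ 'h) set"
  assumes beta_pos: "\<forall>j. 0 < \<beta> $ j"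
    and beta_norm: "(\<Sum>j\<in>UNIV. \<bar>\<beta> $ j\<bar>) \<le> 1"
    and bounds: "\<forall>j. 0 \<le> ul $ j \<and> ul $ j < uu $ j"
    and U: "U = {w. \<forall>j. w $ j \<in> {0..1}}"
    and Q: "Q = {w. \<forall>j. w $ j \<in> {0, 1}}"
    and s: "\<forall>w\<in>U. s w = psi \<beta> (\<chi> j. ul $ j + (uu $ j - ul $ j) * w $ j)"
  shows "supermodular_on Q s \<and> convenv U s = convenv Q s"
proof -
  \<comment> \<open>\<open>s\<close> is prescribed on \<open>U\<close> only; \<open>S\<close> is the
    formula on the whole space, with \<open>uu - ul\<close> as the vector \<open>d\<close> of the
    lemmas.\<close>
  define S where "S w = psi \<beta> (\<chi> j. ul $ j + (uu - ul) $ j * w $ j)" for w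
  have sS: "s w = S w" if "w \<in> U" for w
    using s that by (simp add: S_def)
  have nonneg: "0 \<le> \<beta>" "0 \<le> ul" "0 \<le> uu - ul"
    using beta_pos bounds by (auto simp: less_eq_vec_def less_imp_le)
  have beta_le: "\<beta> $ j \<le> 1" for j
    using member_le_sum[of j UNIV "\<lambda>j. \<bar>\<beta> $ j\<bar>"] beta_norm by auto
  have "Q \<subseteq> U"
    unfolding U Q by (intro Collect_mono impI all_mono) auto
  have U_cbox: "U = cbox 0 1"
    by (auto simp: U mem_box_cart)
  have hull_U: "convex hull U = U"
    unfolding U_cbox by (simp add: convex_box hull_same)
  have hull_Q: "convex hull Q = U"
    using unit_interval_convex_hull[where 'a="real ^ 'h"]
    by (simp add: U_cbox Q Cart_1 Basis_vec_def inner_axis)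
  have "supermodular_on Q S"
    unfolding Q S_def using nonneg by (rule psi_supermodular_on_vertices)
  then have "supermodular_on Q s"
    using sS \<open>Q \<subseteq> U\<close> by (simp add: supermodular_on_def subset_iff)
  moreover have "convenv U s = convenv Q s"
  proof (rule convenv_cong)
    fix g
    \<comment> \<open>This is the passage from \<open>Q\<close> to \<open>U\<close>. The converse is
      restriction to \<open>Q \<subseteq> U\<close>, and convexity is required on the same hull
      \<open>U\<close> in both problems.\<close>
    have "g w \<le> S w" if "convex_on U g" "\<forall>w\<in>Q. g w \<le> S w" "w \<in> U" for w
    proof (rule convex_le_coordinatewise_concave)
      show "(1 - w $ j) * S (vec_upd w j 0) + w $ j * S (vec_upd w j 1) \<le> S w"
        if "w \<in> cbox 0 1" for w j
        unfolding S_def using beta_pos beta_le nonneg that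
        by (intro psi_coordinatewise_concave) auto
    qed (use that in \<open>auto simp: U_cbox Q\<close>)
    then show "convex_underestimator U s g \<longleftrightarrow> convex_underestimator Q s g"
      using sS \<open>Q \<subseteq> U\<close> by (auto simp: convex_underestimator_def hull_U hull_Q subset_iff)
  qed (simp add: hull_U hull_Q)
  ultimately show ?thesis ..
qed

end
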